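(* Let $q=2^r$. We have the following. (a) For even $n\ge2$ and all $q$, the map $\mathbb{F}_q\to C(DC_1^+(n,q))^\perp$, $a\mapsto c_1^+(a)$, is an $\mathbb{F}_2$-linear isomorphism. (b) For even $n\ge4$ and all $q$, or for $n=2$ and $q\ge4$, the map $\mathbb{F}_q\to C(DC_2^+(n,q))^\perp$, $a\mapsto c_2^+(a)$, is an $\mathbb{F}_2$-linear isomorphism. (c) For odd $n\ge3$ and all $q$, or for $n=1$ and $q\ge8$, the map $\mathbb{F}_q\to C(DC_1^-(n,q))^\perp$, $a\mapsto c_1^-(a)$, is an $\mathbb{F}_2$-linear isomorphism. (d) For odd $n\ge3$ and all $q$, the map $\mathbb{F}_q\to C(DC_2^-(n,q))^\perp$, $a\mapsto c_2^-(a)$, is an $\mathbb{F}_2$-linear isomorphism.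
   Context: Let $q=2^r$ and let $\mathbb{F}_q$ be the field with $q$ elements. Let $tr(x)=x+x^2+\cdots+x^{2^{r-1}}$ be the absolute trace to $\mathbb{F}_2$, and let $Tr$ be the matrix trace. $O^+(2n,q)$ is the group of $g\in GL(2n,q)$ preserving $\theta^+(x)=\sum_{i=1}^nx_ix_{n+i}$. $P^+=P^+(2n,q)$ is the subgroup of all products $\begin{bmatrix}A&0\\0&{}^tA^{-1}\end{bmatrix}\begin{bmatrix}1_n&B\\0&1_n\end{bmatrix}$ with $A\in GL(n,q)$ and $B$ an $n\times n$ symmetric matrix with zero diagonal. For $0\le s\le n$, $\sigma_s^+$ is the $2n\times2n$ matrix which, in block form for $2n=s+(n-s)+s+(n-s)$, is $\begin{bmatrix}0&0&1_s&0\\0&1_{n-s}&0&0\\1_s&0&0&0\\0&0&0&1_{n-s}\end{bmatrix}$. The double cosets are: - $DC_1^+(n,q)=P^+\sigma_{n-1}^+P^+$ and $DC_2^+(n,q)=P^+\sigma_{n-2}^+P^+$ for even $n\ge2$; - $DC_1^-(n,q)=P^+\sigma_{n-1}^+P^+$ for odd $n\ge1$; - $DC_2^-(n,q)=P^+\sigma_{n-2}^+P^+$ for odd $n\ge3$. For each such double coset $D=DC_i^\pm(n,q)$, let $N=|D|$ and fix an ordering $g_1,\dots,g_N$ of its elements. The binary code is $C(D)=\{u\in\mathbb{F}_2^N:\sum_{j=1}^Nu_j\,Tr\,g_j=0\text{ in }\mathbb{F}_q\}$. Let $C(D)^\perp$ be its dual code in $\mathbb{F}_2^N$ with respect to the standard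 dot product. By Delsarte's theorem, $C(D)^\perp$ equals the set of vectors $c_i^\pm(a)=(tr(a\,Tr\,g_1),\dots,tr(a\,Tr\,g_N))$ for $a\in\mathbb{F}_q$. *)

theory Defs
  imports "HOL-Library.Z2" "HOL-Library.Cardinality" "Jordan_Normal_Form.VS_Connect"
begin

text \<open>
  The field with \<open>q = 2 ^ r\<close> elements is a type \<open>'a :: finite_field\<close> with \<open>CARD('a) = 2 ^ r\<close>;
  the field \<open>\<F>\<^sub>2\<close> is the type \<^typ>\<open>bit\<close>, embedded into \<open>'a\<close> by \<open>of_bit\<close>.
\<close>

definition abs_trace :: "nat \<Rightarrow> 'a::field \<Rightarrow> 'a" where
  "abs_trace r x = (\<Sum>i<r. x ^ (2 ^ i))"

text \<open>The same trace with its values read as elements of \<^typ>\<open>bit\<close>; see \<open>of_bit_tr\<close> below.\<close>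

definition tr :: "nat \<Rightarrow> 'a::field \<Rightarrow> bit" where
  "tr r x = (THE b. of_bit b = abs_trace r x)"

definition mat_trace :: "'a::comm_monoid_add mat \<Rightarrow> 'a" where
  "mat_trace A = (\<Sum>i<dim_row A. A $$ (i, i))"

text \<open>In \<open>P_plus\<close> the matrix \<open>A'\<close> is the inverse of \<open>A\<close>, so \<open>A\<close> ranges over \<open>GL(n,q)\<close>.\<close>

definition P_plus :: "nat \<Rightarrow> 'a::field mat set" where
  "P_plus n =
    {four_block_mat A (0\<^sub>m n n) (0\<^sub>m n n) (transpose_mat A') *
     four_block_mat (1\<^sub>m n) B (0\<^sub>m n n) (1\<^sub>m n) | A A' B.
       A \<in> carrier_mat n n \<and> A' \<in> carrier_mat n n \<and> inverts_mat A A' \<and> inverts_mat A' A \<and>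
       B \<in> carrier_mat n n \<and> transpose_mat B = B \<and> (\<forall>i<n. B $$ (i, i) = 0)}"

text \<open>
  Grouping \<open>s + (n-s) + s + (n-s)\<close> as \<open>n + n\<close>, each of the four \<open>n \<times> n\<close> blocks of
  \<open>\<sigma>\<^sub>s\<close> is block diagonal of shape \<open>s + (n-s)\<close>.
\<close>

definition sigma_plus :: "nat \<Rightarrow> nat \<Rightarrow> 'a::field mat" where
  "sigma_plus n s =
    (let D = four_block_mat (0\<^sub>m s s) (0\<^sub>m s (n - s)) (0\<^sub>m (n - s) s) (1\<^sub>m (n - s));
         S = four_block_mat (1\<^sub>m s) (0\<^sub>m s (n - s)) (0\<^sub>m (n - s) s) (0\<^sub>m (n - s) (n - s))
     in four_block_mat D S S D)"

definition double_coset :: "'a::semiring_0 mat set \<Rightarrow> 'a mat \<Rightarrow> 'a mat set" where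
  "double_coset P g = {p * g * p' | p p'. p \<in> P \<and> p' \<in> P}"

text \<open>
  \<open>DC1 n\<close> is \<open>DC\<^sub>1\<^sup>+(n,q)\<close> for even \<open>n \<ge> 2\<close> and \<open>DC\<^sub>1\<^sup>-(n,q)\<close> for odd \<open>n \<ge> 1\<close>; \<open>DC2 n\<close> is
  \<open>DC\<^sub>2\<^sup>+(n,q)\<close> for even \<open>n \<ge> 2\<close> and \<open>DC\<^sub>2\<^sup>-(n,q)\<close> for odd \<open>n \<ge> 3\<close>. The sign only records the
  parity of \<open>n\<close>, and other \<open>n\<close> are not used.
\<close>

definition DC1 :: "nat \<Rightarrow> 'a::field mat set" where
  "DC1 n = double_coset (P_plus n) (sigma_plus n (n - 1))"

definition DC2 :: "nat \<Rightarrow> 'a::field mat set" where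
  "DC2 n = double_coset (P_plus n) (sigma_plus n (n - 2))"

definition is_ordering :: "'b list \<Rightarrow> 'b set \<Rightarrow> bool" where
  "is_ordering gs D \<longleftrightarrow> distinct gs \<and> set gs = D"

definition code :: "'a::field mat list \<Rightarrow> bit vec set" where
  "code gs = {u \<in> carrier_vec (length gs).
     (\<Sum>j<length gs. of_bit (u $ j) * mat_trace (gs ! j)) = 0}"

definition dual_code :: "nat \<Rightarrow> bit vec set \<Rightarrow> bit vec set" where
  "dual_code N C = {v \<in> carrier_vec N. \<forall>u\<in>C. u \<bullet> v = 0}"

definition codeword :: "nat \<Rightarrow> 'a::field mat list \<Rightarrow> 'a \<Rightarrow> bit vec" where
  "codeword r gs a = vec (length gs) (\<lambda>j. tr r (a * mat_trace (gs ! j)))"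

text \<open>The type \<open>'a\<close> as a vector space over \<open>\<F>\<^sub>2\<close> (in characteristic 2).\<close>

definition field_over_F2 :: "(bit, 'a::field) module" where
  "field_over_F2 = \<lparr>carrier = UNIV, mult = (*), one = 1, zero = 0, add = (+),
     smult = (\<lambda>b x. of_bit b * x)\<rparr>"

definition F2_linear_iso :: "nat \<Rightarrow> bit vec set \<Rightarrow> ('a::field \<Rightarrow> bit vec) \<Rightarrow> bool" where
  "F2_linear_iso N W f \<longleftrightarrow>
     linear_map class_ring field_over_F2 (module_vec TYPE(bit) N\<lparr>carrier := W\<rparr>) f \<and>
     bij_betw f UNIV W"

text \<open>Well-definedness of \<^const>\<open>tr\<close>, and existence of the orderings.\<close>

lemma two_eq_zero:
  assumes "CARD('a::finite_field) = 2 ^ r"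
  shows "(2::'a) = 0"
proof -
  have "r \<noteq> 0"
  proof
    assume "r = 0"
    then have "CARD('a) = 1" using assms by simp
    then have "(0 :: 'a) = 1" by (metis UNIV_I card_1_singletonE singletonD)
    then show False by simp
  qed
  then have "(- 1 :: 'a) ^ (2 ^ r) = 1"
    by simp
  then have "- 1 = (1 :: 'a)"
    using finite_field_power_card_eq_same[of "- 1 :: 'a"] assms by simp
  then show ?thesis
    by (metis add.right_inverse one_add_one)
qed

lemma abs_trace_square:
  assumes "CARD('a::finite_field) = 2 ^ r"
  shows "abs_trace r (x::'a) ^ 2 = abs_trace r x"
proof -
  have add_sq: "(y + z) ^ 2 = y ^ 2 + z ^ 2" for y z :: 'a
    using two_eq_zero[OF assms] by (simp add: power2_sum)
  have sum_sq: "(\<Sum>i<k. x ^ (2 ^ i)) ^ 2 = (\<Sum>i<k. x ^ (2 ^ Suc i))" for k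
    by (induction k) (simp_all add: add_sq power_mult[symmetric] mult.commute)
  have "(\<Sum>i<Suc r. x ^ (2 ^ i)) = x + (\<Sum>i<r. x ^ (2 ^ Suc i))"
    by (subst sum.lessThan_Suc_shift) simp
  moreover have "(\<Sum>i<Suc r. x ^ (2 ^ i)) = abs_trace r x + x"
    using finite_field_power_card_eq_same[of x] assms by (simp add: abs_trace_def)
  ultimately show ?thesis
    using sum_sq[of r] by (simp add: abs_trace_def)
qed

lemma of_bit_tr:
  assumes "CARD('a::finite_field) = 2 ^ r"
  shows "of_bit (tr r x) = abs_trace r (x::'a)"
proof -
  have "abs_trace r x * (abs_trace r x - 1) = 0"
    using abs_trace_square[OF assms, of x] by (simp add: algebra_simps power2_eq_square)
  then consider "abs_trace r x = of_bit 0" | "abs_trace r x = of_bit 1"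
    by auto
  then have "\<exists>b. of_bit b = abs_trace r x"
    by cases metis+
  moreover have "b = c" if "(of_bit b :: 'a) = of_bit c" for b c
    using that by (cases b; cases c) auto
  ultimately have "\<exists>!b. of_bit b = abs_trace r x"
    by metis
  then show ?thesis
    unfolding tr_def by (rule theI')
qed

lemma finite_carrier_mat: "finite (carrier_mat m k :: 'a::finite mat set)"
proof (rule finite_subset)
  show "carrier_mat m k \<subseteq> mat m k ` (PiE ({..<m} \<times> {..<k}) (\<lambda>_. UNIV :: 'a set))"
  proof
    fix A :: "'a mat" assume "A \<in> carrier_mat m k"
    then have "A = mat m k (restrict (\<lambda>p. A $$ p) ({..<m} \<times> {..<k}))"
      by (intro eq_matI) auto
    moreover have "restrict (\<lambda>p. A $$ p) ({..<m} \<times> {..<k}) \<in> PiE ({..<m} \<times> {..<k}) (\<lambda>_. UNIV)"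
      by simp
    ultimately show "A \<in> mat m k ` (PiE ({..<m} \<times> {..<k}) (\<lambda>_. UNIV))"
      by (metis imageI)
  qed
qed (intro finite_imageI finite_PiE; simp)

lemma P_plus_carrier: "P_plus n \<subseteq> carrier_mat (n + n) (n + n)"
  unfolding P_plus_def by auto

lemma finite_double_coset:
  "finite (double_coset (P_plus n) g :: 'a::finite_field mat set)"
proof (rule finite_subset)
  show "double_coset (P_plus n) g \<subseteq> carrier_mat (n + n) (n + n)"
    using P_plus_carrier unfolding double_coset_def by fastforce
qed (rule finite_carrier_mat)

lemma ex_ordering:
  "\<exists>gs. is_ordering gs (DC1 n :: 'a::finite_field mat set)"
  "\<exists>gs. is_ordering gs (DC2 n :: 'a::finite_field mat set)"
  unfolding is_ordering_def DC1_def DC2_def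
  using finite_distinct_list[OF finite_double_coset] by blast+

end

theory Submission
  imports Defs "Jordan_Normal_Form.Gauss_Jordan_Elimination"
begin

text \<open>
  A character sum argument proves Delsarte's theorem, so the map is onto the dual code, and it
  remains to see that no \<open>a \<noteq> 0\<close> satisfies \<open>tr (a Tr g) = 0\<close> for all \<open>g\<close> in the double coset.
  For \<open>0 < s < n\<close> every \<open>c\<close> is a trace on \<open>P\<^sup>+\<sigma>\<^sub>sP\<^sup>+\<close>: take \<open>A = 1 + c E\<^sub>1\<^sub>2\<close> and
  \<open>B = E\<^sub>1\<^sub>2 + E\<^sub>2\<^sub>1\<close>. The cases with \<open>s = 0\<close> are separate: for \<open>n = 2\<close>, \<open>q \<ge> 4\<close> the traces
  \<open>Tr A + Tr A\<^sup>-\<^sup>1\<close> still exhaust the field, and for \<open>n = 1\<close> the traces are \<open>a + a\<^sup>-\<^sup>1\<close>, where a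
  degree count shows injectivity if \<open>q \<ge> 8\<close>.
\<close>

text \<open>By default the simplifier turns addition and multiplication of bits into bit operations.\<close>
declare add_bit_eq_xor [simp del] mult_bit_eq_and [simp del]

section \<open>The absolute trace as a nonzero F_2-linear functional\<close>

lemma add_power_two_power:
  assumes "(2 :: 'a::comm_ring_1) = 0"
  shows "(x + y :: 'a) ^ (2 ^ i) = x ^ (2 ^ i) + y ^ (2 ^ i)"
proof (induction i)
  case (Suc i)
  have "(x + y) ^ (2 ^ Suc i) = ((x + y) ^ (2 ^ i)) ^ 2"
    by (simp add: power_mult[symmetric] mult.commute)
  also have "\<dots> = (x ^ (2 ^ i)) ^ 2 + (y ^ (2 ^ i)) ^ 2"
    using assms by (simp add: Suc power2_sum)
  finally show ?case
    by (simp add: power_mult[symmetric] mult.commute)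
qed simp

lemma of_bit_add:
  assumes "(2 :: 'a::comm_ring_1) = 0"
  shows "of_bit (b + c) = (of_bit b + of_bit c :: 'a)"
  using assms by (cases b; cases c) auto

lemma of_bit_eq_iff: "(of_bit b :: 'a::zero_neq_one) = of_bit c \<longleftrightarrow> b = c"
  by (cases b; cases c) auto

lemma bit_add_self: "b + b = (0 :: bit)"
  by (cases b) auto

context
  fixes r :: nat
  assumes q: "CARD('a::finite_field) = 2 ^ r"
begin

lemma tr_add: "tr r (x + y :: 'a) = tr r x + tr r y"
proof -
  have "abs_trace r (x + y) = abs_trace r x + abs_trace r y"
    using two_eq_zero[OF q] by (simp add: abs_trace_def add_power_two_power sum.distrib)
  then have "(of_bit (tr r (x + y)) :: 'a) = of_bit (tr r x + tr r y)"
    by (simp only: of_bit_tr[OF q] of_bit_add[OF two_eq_zero[OF q]])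
  then show ?thesis
    by (simp only: of_bit_eq_iff)
qed

lemma tr_zero: "tr r (0 :: 'a) = 0"
  using tr_add[of 0 0] by (cases "tr r (0 :: 'a)") auto

lemma tr_of_bit_mult: "tr r (of_bit b * x :: 'a) = b * tr r x"
  using tr_zero by (cases b) auto

lemma tr_sum: "tr r (\<Sum>i\<in>I. f i :: 'a) = (\<Sum>i\<in>I. tr r (f i))"
  by (induction I rule: infinite_finite_induct) (simp_all add: tr_zero tr_add)

lemma tr_eq_0_iff: "tr r (x :: 'a) = 0 \<longleftrightarrow> abs_trace r x = 0"
  unfolding of_bit_tr[OF q, symmetric] by (cases "tr r x") auto

lemma exponent_pos: "r > 0"
proof (rule ccontr)
  assume "\<not> ?thesis"
  then have "CARD('a) = 1" using q by simp
  then have "(0 :: 'a) = 1" by (metis UNIV_I card_1_singletonE singletonD)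
  then show False by simp
qed

text \<open>The trace is a polynomial function of degree less than q with linear coefficient 1, so
  it cannot vanish at all q points.\<close>

lemma ex_tr_neq_0: "\<exists>x::'a. tr r x \<noteq> 0"
proof (rule ccontr)
  assume "\<not> ?thesis"
  then have vanish: "abs_trace r x = 0" for x :: 'a
    using tr_eq_0_iff by blast
  define p :: "'a poly" where "p = (\<Sum>i<r. monom 1 (2 ^ i))"
  have "degree p \<le> 2 ^ r - 1"
    unfolding p_def
  proof (intro degree_sum_le)
    fix i assume "i \<in> {..<r}"
    then have "(2::nat) ^ i < 2 ^ r" by simp
    then have "(2::nat) ^ i \<le> 2 ^ r - 1" by linarith
    then show "degree (monom (1::'a) (2 ^ i)) \<le> 2 ^ r - 1"
      by (simp add: degree_monom_eq)
  qed simp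
  then have "degree p < CARD('a)"
    using q by (simp add: less_eq_iff_succ_less)
  moreover have "poly p x = 0" for x
    using vanish[of x] by (simp add: p_def poly_sum poly_monom abs_trace_def)
  ultimately have "p = 0"
    by (intro poly_eqI_degree[of UNIV]) auto
  moreover have "coeff p 1 = 1"
  proof -
    have "coeff p 1 = (\<Sum>i<r. if i = 0 then 1 else 0)"
      unfolding p_def coeff_sum by (intro sum.cong) auto
    then show ?thesis using exponent_pos by simp
  qed
  ultimately show False by simp
qed

text \<open>
  Since \<open>x\<^bsup>-2^i\<^esup> = x\<^bsup>q-1-2^i\<^esup>\<close> for \<open>x \<noteq> 0\<close>, the hypothesis is the vanishing at all \<open>q - 1\<close> nonzero
  points of a polynomial of degree at most \<open>q - 2\<close>. For \<open>q \<ge> 8\<close> no \<open>q - 1 - 2^i\<close> equals 1, so its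
  linear coefficient is \<open>b\<close>.
\<close>
lemma tr_add_inverse_eq_0_imp:
  fixes b :: 'a
  assumes card: "CARD('a) \<ge> 8" and vanish: "\<And>a. a \<noteq> 0 \<Longrightarrow> tr r (b * (a + inverse a)) = 0"
  shows "b = 0"
proof -
  have "(2::nat) ^ 3 \<le> 2 ^ r" using card q by simp
  then have r: "r \<ge> 3" by (simp only: power_increasing_iff)
  have pow: "2 * 2 ^ i \<le> (2::nat) ^ r" if "i < r" for i
    using that power_increasing[of "Suc i" r "2::nat"] by simp
  define p :: "'a poly" where
    "p = (\<Sum>i<r. monom (b ^ (2 ^ i)) (2 ^ i) + monom (b ^ (2 ^ i)) (2 ^ r - 1 - 2 ^ i))"
  have deg: "degree p \<le> 2 ^ r - 2"
    unfolding p_def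
  proof (intro degree_sum_le degree_add_le)
    fix i assume "i \<in> {..<r}"
    then have "2 * 2 ^ i \<le> (2::nat) ^ r" using pow by simp
    moreover have "(2::nat) ^ r \<ge> 8" using card q by simp
    ultimately have "2 ^ i \<le> (2::nat) ^ r - 2" by linarith
    then show "degree (monom (b ^ (2 ^ i)) (2 ^ i)) \<le> 2 ^ r - 2"
      using degree_monom_le order.trans by blast
    have "2 ^ r - 1 - 2 ^ i \<le> (2::nat) ^ r - 2"
      using one_le_power[of "2::nat" i] by linarith
    then show "degree (monom (b ^ (2 ^ i)) (2 ^ r - 1 - 2 ^ i)) \<le> 2 ^ r - 2"
      using degree_monom_le order.trans by blast
  qed simp
  have inv: "x ^ (2 ^ r - 1 - 2 ^ i) = inverse x ^ (2 ^ i)" if "x \<noteq> 0" "i < r" for x :: 'a and i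
  proof -
    have "x * x ^ (2 ^ r - 1) = x * 1"
      using finite_field_power_card_eq_same[of x] q by (simp flip: power_Suc)
    then have 1: "x ^ (2 ^ r - 1) = 1"
      using that by simp
    \<comment> \<open>This bound makes the natural-number subtraction in the exponent a true
      one.\<close>
    have "2 ^ i \<le> (2::nat) ^ r - 1"
      using pow[OF that(2)] one_le_power[of "2::nat" i] by linarith
    then have "x ^ (2 ^ r - 1 - 2 ^ i) * x ^ (2 ^ i) = 1"
      by (metis 1 le_add_diff_inverse2 power_add)
    also have "\<dots> = inverse x ^ (2 ^ i) * x ^ (2 ^ i)"
      using that by (simp flip: power_mult_distrib)
    finally show ?thesis
      using that by simp
  qed
  have "poly p x = 0" if "x \<in> UNIV - {0}" for x
  proof -
    have "poly p x = (\<Sum>i<r. (b * x) ^ (2 ^ i) + (b * inverse x) ^ (2 ^ i))"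
      unfolding p_def poly_sum poly_add poly_monom
      using that inv by (intro sum.cong) (auto simp: power_mult_distrib)
    also have "\<dots> = abs_trace r (b * (x + inverse x))"
      using two_eq_zero[OF q] by (simp add: abs_trace_def add_power_two_power distrib_left)
    also have "\<dots> = 0"
      using vanish that tr_eq_0_iff by blast
    finally show ?thesis .
  qed
  moreover have "degree p < card (UNIV - {0::'a})"
    using deg card q by (simp add: card_Diff_singleton)
  ultimately have "p = 0"
    by (intro poly_eqI_degree[of "UNIV - {0}"]) auto
  moreover have "coeff p 1 = b"
  proof -
    have "2 ^ r - 1 - 2 ^ i \<noteq> (1::nat)" if "i < r" for i
    proof
      assume "2 ^ r - 1 - 2 ^ i = (1::nat)"
      then have eq: "2 ^ r = 2 + (2::nat) ^ i" by linarith
      \<comment> \<open>The right side 2 + 2^i is 3 or 4 for i < 2, which is below 8, and is 2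
        modulo 4 for all larger i.\<close>
      have "4 dvd (2::nat) ^ r"
        using le_imp_power_dvd[of 2 r "2::nat"] r by simp
      have "(8::nat) \<le> 2 ^ r" using card q by simp
      consider "i = 0" | "i = 1" | "i \<ge> 2" by linarith
      then show False
      proof cases
        case 3
        then have "4 dvd (2::nat) ^ i"
          using le_imp_power_dvd[of 2 i "2::nat"] by simp
        then show False
          using \<open>4 dvd (2::nat) ^ r\<close> eq by presburger
      qed (use eq \<open>8 \<le> 2 ^ r\<close> in simp_all)
    qed
    then have "coeff p 1 = (\<Sum>i<r. if i = 0 then b else 0)"
      unfolding p_def coeff_sum coeff_add by (intro sum.cong) auto
    then show ?thesis using r by simp
  qed
  ultimately show ?thesis by simp
qed

end

section \<open>Character sums and Delsarte's theorem\<close>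

definition sign_char :: "bit \<Rightarrow> int" where
  "sign_char b = (if b = 0 then 1 else - 1)"

lemma sign_char_add: "sign_char (b + c) = sign_char b * sign_char c"
  by (cases b; cases c) (auto simp: sign_char_def)

text \<open>The permutation \<open>s\<close> flips every sign, so the integer sum equals its own
  negative.\<close>

lemma sum_sign_char_eq_0:
  assumes "bij_betw s X X" "\<And>x. x \<in> X \<Longrightarrow> f (s x) = f x + 1"
  shows "(\<Sum>x\<in>X. sign_char (f x)) = 0"
proof -
  have "(\<Sum>x\<in>X. sign_char (f x)) = (\<Sum>x\<in>X. sign_char (f (s x)))"
    using sum.reindex_bij_betw[OF assms(1), of "\<lambda>x. sign_char (f x)"] by simp
  also have "\<dots> = - (\<Sum>x\<in>X. sign_char (f x))"
    using assms(2) by (simp add: sign_char_add sum_negf[symmetric] sign_char_def[of 1])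
  finally show ?thesis by simp
qed

text \<open>Orthogonality of additive characters: for x \<noteq> 0, translating a by y / x with tr y
  = 1 flips every sign.\<close>

lemma sum_sign_char_tr:
  assumes q: "CARD('a::finite_field) = 2 ^ r"
  shows "(\<Sum>a\<in>UNIV. sign_char (tr r (a * x :: 'a))) = (if x = 0 then 2 ^ r else 0)"
proof (cases "x = 0")
  case False
  obtain y :: 'a where y: "tr r y \<noteq> 0"
    using ex_tr_neq_0[OF q] by blast
  have "(\<Sum>a\<in>UNIV. sign_char (tr r (a * x))) = 0"
  proof (rule sum_sign_char_eq_0)
    show "bij_betw (\<lambda>a. a + y / x) UNIV (UNIV :: 'a set)"
      by (rule bij_betwI[of _ _ _ "\<lambda>a. a - y / x"]) auto
    show "tr r ((a + y / x) * x) = tr r (a * x) + 1" for a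
      using False y by (simp add: distrib_right tr_add[OF q])
  qed
  then show ?thesis using False by simp
qed (use q in \<open>simp add: tr_zero[OF q] sign_char_def\<close>)

lemma finite_carrier_vec_bit: "finite (carrier_vec N :: bit vec set)"
proof (rule finite_subset)
  have "finite (UNIV :: bit set)"
    by (rule finite_subset[of _ "{0, 1}"]) (auto intro: bit.exhaust)
  then show "finite (vec N ` PiE {..<N} (\<lambda>_. UNIV :: bit set))"
    by (intro finite_imageI finite_PiE) auto
  show "carrier_vec N \<subseteq> vec N ` PiE {..<N} (\<lambda>_. UNIV :: bit set)"
  proof
    fix v :: "bit vec" assume "v \<in> carrier_vec N"
    then have "v = vec N (restrict (($) v) {..<N})"
      by (intro eq_vecI) auto
    then show "v \<in> vec N ` PiE {..<N} (\<lambda>_. UNIV)"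
      by (metis imageI PiE_UNIV_domain UNIV_I restrict_PiE_iff)
  qed
qed

text \<open>If some coordinate of w is 1, flipping that coordinate of u changes the sign of every
  term, so the sum cancels.\<close>

lemma eq_0_if_sum_sign_char_neq_0:
  assumes w: "w \<in> carrier_vec N" and neq: "(\<Sum>u\<in>carrier_vec N. sign_char (u \<bullet> w)) \<noteq> 0"
  shows "w = 0\<^sub>v N"
proof (rule ccontr)
  assume "w \<noteq> 0\<^sub>v N"
  then obtain i where i: "i < N" "w $ i = 1"
    using w by (metis bit_not_zero_iff carrier_vecD eq_vecI index_zero_vec)
  have "(\<Sum>u\<in>carrier_vec N. sign_char (u \<bullet> w)) = 0"
  proof (rule sum_sign_char_eq_0)
    have "u + unit_vec N i + unit_vec N i = u" if "u \<in> carrier_vec N" for u :: "bit vec"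
      using that by (intro eq_vecI) (auto simp: add.assoc bit_add_self)
    then show "bij_betw (\<lambda>u. u + unit_vec N i) (carrier_vec N) (carrier_vec N :: bit vec set)"
      by (intro bij_betwI[of _ _ _ "\<lambda>u. u + unit_vec N i"]) auto
    show "(u + unit_vec N i) \<bullet> w = u \<bullet> w + 1" if "u \<in> carrier_vec N" for u
      using that w i by (simp add: add_scalar_prod_distrib[of _ N])
  qed
  with neq show False by simp
qed

text \<open>The trace is F_2-linear and so comes out of the sum. What remains inside is a times the
  sum whose vanishing defines \<open>code\<close>.\<close>

lemma scalar_prod_codeword:
  assumes q: "CARD('a::finite_field) = 2 ^ r" and u: "u \<in> carrier_vec (length gs)"
  shows "u \<bullet> codeword r gs a = tr r (a * (\<Sum>j<length gs. of_bit (u $ j) * mat_trace (gs ! j :: 'a mat)))"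
proof -
  have "a * (\<Sum>j<length gs. of_bit (u $ j) * mat_trace (gs ! j)) =
      (\<Sum>j<length gs. of_bit (u $ j) * (a * mat_trace (gs ! j)))"
    unfolding sum_distrib_left by (rule sum.cong) (simp_all only: ac_simps)
  then show ?thesis
    using u unfolding scalar_prod_def
    by (simp only: tr_sum[OF q] tr_of_bit_mult[OF q] codeword_def dim_vec
        atLeast0LessThan) (intro sum.cong; simp)
qed

lemma codeword_carrier: "codeword r gs a \<in> carrier_vec (length gs)"
  by (simp add: codeword_def)

lemma codeword_add:
  assumes "CARD('a::finite_field) = 2 ^ r"
  shows "codeword r gs (a + b) = codeword r gs a + codeword r gs (b :: 'a)"
  by (intro eq_vecI) (auto simp: codeword_def distrib_right tr_add[OF assms])

lemma codeword_smult:
  assumes "CARD('a::finite_field) = 2 ^ r"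
  shows "codeword r gs (of_bit b * a :: 'a) = b \<cdot>\<^sub>v codeword r gs a"
  by (cases b) (auto simp: codeword_def tr_zero[OF assms])

text \<open>
  Delsarte's theorem. For \<open>v\<close> in the dual code, evaluating
  \<open>\<Sum>\<^sub>a \<Sum>\<^sub>u (-1)\<^bsup>u \<bullet> (v + c(a))\<^esup>\<close> by summing over \<open>a\<close> first gives \<open>q |C| \<noteq> 0\<close>, so some inner
  sum over \<open>u\<close> is nonzero, which forces \<open>v = c(a)\<close>.
\<close>
lemma dual_code_eq_range_codeword:
  assumes q: "CARD('a::finite_field) = 2 ^ r"
  shows "dual_code (length gs) (code (gs :: 'a mat list)) = range (codeword r gs)"
proof (intro equalityI subsetI)
  fix v assume "v \<in> range (codeword r gs)"
  then show "v \<in> dual_code (length gs) (code gs)"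
    by (auto simp: dual_code_def code_def codeword_carrier scalar_prod_codeword[OF q] tr_zero[OF q])
next
  let ?N = "length gs"
  define \<phi> :: "bit vec \<Rightarrow> 'a" where "\<phi> u = (\<Sum>j<?N. of_bit (u $ j) * mat_trace (gs ! j))" for u
  fix v assume v: "v \<in> dual_code ?N (code gs)"
  then have vc: "v \<in> carrier_vec ?N" by (simp add: dual_code_def)
  have sp: "u \<bullet> (v + codeword r gs a) = u \<bullet> v + tr r (a * \<phi> u)" if "u \<in> carrier_vec ?N" for u a
    using that vc by (simp only: scalar_prod_add_distrib[OF _ _ codeword_carrier]
        scalar_prod_codeword[OF q] \<phi>_def)
  have "(\<Sum>a\<in>UNIV. \<Sum>u\<in>carrier_vec ?N. sign_char (u \<bullet> (v + codeword r gs a))) =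
      (\<Sum>u\<in>carrier_vec ?N. sign_char (u \<bullet> v) * (\<Sum>a\<in>UNIV. sign_char (tr r (a * \<phi> u))))"
    by (subst sum.swap) (simp add: sp sign_char_add sum_distrib_left)
  \<comment> \<open>The inner sum survives only for u in the code, and there u is orthogonal to v,
    so its sign is 1.\<close>
  also have "\<dots> = (\<Sum>u\<in>carrier_vec ?N. if \<phi> u = 0 then 2 ^ r else 0)"
    using v unfolding sum_sign_char_tr[OF q]
    by (intro sum.cong) (auto simp: dual_code_def code_def \<phi>_def sign_char_def)
  also have "\<dots> > 0"
  proof (rule sum_pos2[of _ "0\<^sub>v ?N"])
    show "0 < (if \<phi> (0\<^sub>v ?N) = 0 then 2 ^ r else 0 :: int)"
      by (simp add: \<phi>_def)
  qed (auto simp: finite_carrier_vec_bit)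
  finally obtain a where "(\<Sum>u\<in>carrier_vec ?N. sign_char (u \<bullet> (v + codeword r gs a))) \<noteq> 0"
    by (metis (mono_tags, lifting) less_irrefl sum.neutral)
  then have "v + codeword r gs a = 0\<^sub>v ?N"
    using vc by (intro eq_0_if_sum_sign_char_neq_0 add_carrier_vec codeword_carrier)
  then have "v $ i + codeword r gs a $ i = 0" if "i < ?N" for i
    using that vc codeword_carrier[of r gs a] by (metis carrier_vecD index_add_vec(1) index_zero_vec(1))
  then have "v $ i = codeword r gs a $ i" if "i < ?N" for i
    using that by (metis add_left_imp_eq add.commute bit_add_self)
  then have "v = codeword r gs a"
    using vc codeword_carrier[of r gs a] by (intro eq_vecI) auto
  then show "v \<in> range (codeword r gs)" by simp
qed

section \<open>From a trivial kernel to an F_2-linear isomorphism\<close>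

lemma vectorspace_field_over_F2:
  assumes "(2 :: 'a::field) = 0"
  shows "vectorspace class_ring (field_over_F2 :: (bit, 'a) module)"
proof -
  have "abelian_group (field_over_F2 :: (bit, 'a) module)"
    by (rule abelian_groupI) (auto simp: field_over_F2_def ac_simps intro: exI[of _ "- _"])
  then have "Module.module class_ring (field_over_F2 :: (bit, 'a) module)"
  proof (intro moduleI class_cring.is_cring)
    fix b c :: bit and x :: 'a
    show "(b \<oplus>\<^bsub>class_ring\<^esub> c) \<odot>\<^bsub>field_over_F2\<^esub> x =
        b \<odot>\<^bsub>field_over_F2\<^esub> x \<oplus>\<^bsub>field_over_F2\<^esub> c \<odot>\<^bsub>field_over_F2\<^esub> x"
      using assms by (cases b; cases c) (auto simp: field_over_F2_def simp flip: mult_2)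
  qed (auto simp: field_over_F2_def distrib_left)
  then show ?thesis
    by (simp add: vectorspace_def class_field)
qed

lemma vectorspace_dual_code:
  assumes "C \<subseteq> carrier_vec N"
  shows "vectorspace class_ring (module_vec TYPE(bit) N\<lparr>carrier := dual_code N C\<rparr>)"
proof -
  have "submodule class_ring (dual_code N C) (module_vec TYPE(bit) N)"
    using assms
    by (intro submodule.intro vec_module)
      (auto simp: dual_code_def module_vec_simps scalar_prod_add_distrib[of _ N] subset_iff)
  then show ?thesis
    using vectorspace.subspace_is_vs[OF vec_vs] vec_vs by (auto simp: subspace_def)
qed

lemma F2_linear_iso_codeword:
  assumes q: "CARD('a::finite_field) = 2 ^ r"
    and kernel: "\<And>a. \<forall>g\<in>set gs. tr r (a * mat_trace g) = 0 \<Longrightarrow> a = (0 :: 'a)"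
  shows "F2_linear_iso (length gs) (dual_code (length gs) (code gs)) (codeword r gs)"
proof -
  let ?W = "dual_code (length gs) (code gs)"
  have "linear_map class_ring field_over_F2 (module_vec TYPE(bit) (length gs)\<lparr>carrier := ?W\<rparr>)
      (codeword r gs)"
  proof -
    have V: "vectorspace class_ring (field_over_F2 :: (bit, 'a) module)"
      using two_eq_zero[OF q] by (rule vectorspace_field_over_F2)
    have W: "vectorspace class_ring (module_vec TYPE(bit) (length gs)\<lparr>carrier := ?W\<rparr>)"
      by (rule vectorspace_dual_code) (auto simp: code_def)
    have "codeword r gs \<in> LinearCombinations.module_hom class_ring field_over_F2
        (module_vec TYPE(bit) (length gs)\<lparr>carrier := ?W\<rparr>)"
      by (auto simp: LinearCombinations.module_hom_def field_over_F2_def module_vec_simps codeword_add[OF q]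
          dual_code_eq_range_codeword[OF q] intro: codeword_smult[OF q, where b = 0, simplified])
    with V W show ?thesis
      by (simp add: linear_map_def mod_hom_def mod_hom_axioms_def vectorspace_def)
  qed
  moreover have "inj (codeword r gs)"
  proof (rule injI)
    fix a b assume "codeword r gs a = codeword r gs b"
    \<comment> \<open>In characteristic 2 the sum a + b serves as the difference.\<close>
    then have "codeword r gs (a + b) = 0\<^sub>v (length gs)"
      unfolding codeword_add[OF q]
      by (intro eq_vecI) (auto simp: codeword_def bit_add_self)
    then have "tr r ((a + b) * mat_trace (gs ! j)) = 0" if "j < length gs" for j
      using that by (metis codeword_def index_vec index_zero_vec(1))
    then have "a + b = 0"
      by (intro kernel) (auto simp: in_set_conv_nth)
    moreover have "b + b = 0"
      using two_eq_zero[OF q] by (simp flip: mult_2)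
    ultimately show "a = b"
      by (metis add_right_cancel)
  qed
  ultimately show ?thesis
    by (simp add: F2_linear_iso_def bij_betw_def dual_code_eq_range_codeword[OF q])
qed

text \<open>If a \<noteq> 0, an element g with matrix trace y / a gives tr (a Tr g) = tr y, which is
  nonzero for a suitable y.\<close>

lemma F2_linear_iso_of_surj_trace:
  assumes q: "CARD('a::finite_field) = 2 ^ r" and surj: "\<And>c. \<exists>g\<in>set gs. mat_trace g = (c :: 'a)"
  shows "F2_linear_iso (length gs) (dual_code (length gs) (code gs)) (codeword r gs)"
proof (rule F2_linear_iso_codeword[OF q])
  fix a :: 'a assume *: "\<forall>g\<in>set gs. tr r (a * mat_trace g) = 0"
  obtain y :: 'a where "tr r y \<noteq> 0"
    using ex_tr_neq_0[OF q] by blast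
  moreover obtain g where "g \<in> set gs" "mat_trace g = y / a"
    using surj by blast
  ultimately show "a = 0"
    using * by (metis nonzero_mult_div_cancel_left times_divide_eq_right)
qed

section \<open>Matrix traces on the double cosets\<close>

lemma mat_trace_four_block_mat:
  assumes "A \<in> carrier_mat n n" "D \<in> carrier_mat m m"
  shows "mat_trace (four_block_mat A B C D) = mat_trace A + mat_trace D"
proof -
  have "mat_trace (four_block_mat A B C D) = (\<Sum>i<n+m. four_block_mat A B C D $$ (i, i))"
    using assms by (simp add: mat_trace_def)
  also have "\<dots> = (\<Sum>i<n. four_block_mat A B C D $$ (i, i)) +
      (\<Sum>i<m. four_block_mat A B C D $$ (n + i, n + i))"
    by (induction m) (simp_all add: add.assoc)
  also have "\<dots> = mat_trace A + mat_trace D"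
    using assms by (simp add: mat_trace_def)
  finally show ?thesis .
qed

text \<open>
  The diagonal blocks of \<open>p \<sigma>\<^sub>s\<close> for \<open>p \<in> P\<^sup>+\<close>: right multiplication by the blocks of \<open>\<sigma>\<^sub>s\<close>
  keeps the last \<open>n - s\<close>, respectively the first \<open>s\<close>, columns.
\<close>
lemma ex_double_coset_mat_trace:
  fixes A A' B :: "'a::field mat"
  assumes s: "s \<le> n" and A: "A \<in> carrier_mat n n" "A' \<in> carrier_mat n n"
    and inv: "inverts_mat A A'" "inverts_mat A' A"
    and B: "B \<in> carrier_mat n n" "transpose_mat B = B" "\<forall>i<n. B $$ (i, i) = 0"
  shows "\<exists>g \<in> double_coset (P_plus n) (sigma_plus n s). mat_trace g =
    (\<Sum>i=s..<n. A $$ (i, i) + A' $$ (i, i)) + (\<Sum>i<s. (A * B) $$ (i, i))"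
proof -
  define D :: "'a mat" where
    "D = four_block_mat (0\<^sub>m s s) (0\<^sub>m s (n - s)) (0\<^sub>m (n - s) s) (1\<^sub>m (n - s))"
  define S :: "'a mat" where
    "S = four_block_mat (1\<^sub>m s) (0\<^sub>m s (n - s)) (0\<^sub>m (n - s) s) (0\<^sub>m (n - s) (n - s))"
  have D: "D \<in> carrier_mat n n" and S: "S \<in> carrier_mat n n"
    using s four_block_carrier_mat[of _ s s _ "n - s" "n - s"] unfolding D_def S_def by fastforce+
  have Dij: "D $$ (i, j) = (if i = j \<and> s \<le> i then 1 else 0)"
    and Sij: "S $$ (i, j) = (if i = j \<and> i < s then 1 else 0)" if "i < n" "j < n" for i j
    using that s unfolding D_def S_def by auto
  have MD: "mat_trace (M * D) = (\<Sum>i=s..<n. M $$ (i, i))" if M: "M \<in> carrier_mat n n" for M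
  proof -
    have "(M * D) $$ (i, i) = (if s \<le> i then M $$ (i, i) else 0)" if "i < n" for i
    proof -
      have "(M * D) $$ (i, i) = (\<Sum>k = 0..<n. M $$ (i, k) * D $$ (k, i))"
        using that M D by (simp add: scalar_prod_def)
      also have "\<dots> = (\<Sum>k = 0..<n. if k = i then (if s \<le> i then M $$ (i, i) else 0) else 0)"
        using that by (intro sum.cong) (auto simp: Dij)
      finally show ?thesis using that by simp
    qed
    then have "mat_trace (M * D) = (\<Sum>i<n. if s \<le> i then M $$ (i, i) else 0)"
      using M by (simp add: mat_trace_def)
    also have "\<dots> = (\<Sum>i=s..<n. M $$ (i, i))"
      by (rule sum.mono_neutral_cong_right) auto
    finally show ?thesis .
  qed
  have MS: "mat_trace (M * S) = (\<Sum>i<s. M $$ (i, i))" if M: "M \<in> carrier_mat n n" for M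
  proof -
    have "(M * S) $$ (i, i) = (if i < s then M $$ (i, i) else 0)" if "i < n" for i
    proof -
      have "(M * S) $$ (i, i) = (\<Sum>k = 0..<n. M $$ (i, k) * S $$ (k, i))"
        using that M S by (simp add: scalar_prod_def)
      also have "\<dots> = (\<Sum>k = 0..<n. if k = i then (if i < s then M $$ (i, i) else 0) else 0)"
        using that by (intro sum.cong) (auto simp: Sij)
      finally show ?thesis using that by simp
    qed
    then have "mat_trace (M * S) = (\<Sum>i<n. if i < s then M $$ (i, i) else 0)"
      using M by (simp add: mat_trace_def)
    also have "\<dots> = (\<Sum>i<s. M $$ (i, i))"
      using s by (intro sum.mono_neutral_cong_right) auto
    finally show ?thesis .
  qed
  define p where "p = four_block_mat A (0\<^sub>m n n) (0\<^sub>m n n) (transpose_mat A') *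
    four_block_mat (1\<^sub>m n) B (0\<^sub>m n n) (1\<^sub>m n)"
  have "p \<in> P_plus n"
    unfolding P_plus_def p_def using assms by blast
  \<comment> \<open>Since \<open>p\<close> is block upper triangular, \<open>B\<close> affects the
    trace of \<open>p * sigma_plus n s\<close> only through the upper left block.\<close>
  have p: "p = four_block_mat A (A * B) (0\<^sub>m n n) (transpose_mat A')"
    unfolding p_def using A B
    by (subst mult_four_block_mat[of _ n n _ n _ n _ _ n _ n]) auto
  \<comment> \<open>The right factor from \<open>P_plus n\<close> is taken to be the
    identity.\<close>
  have one: "1\<^sub>m (n + n) \<in> (P_plus n :: 'a mat set)"
  proof -
    have "1\<^sub>m (n + n) = four_block_mat (1\<^sub>m n) (0\<^sub>m n n) (0\<^sub>m n n) (transpose_mat (1\<^sub>m n)) *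
        four_block_mat (1\<^sub>m n) (0\<^sub>m n n) (0\<^sub>m n n) (1\<^sub>m n :: 'a mat)"
      by simp
    then show ?thesis
      unfolding P_plus_def by (intro CollectI exI[of _ "1\<^sub>m n"] exI[of _ "0\<^sub>m n n"])
        (auto simp: inverts_mat_def)
  qed
  have sig: "sigma_plus n s = four_block_mat D S S D"
    by (simp add: sigma_plus_def D_def S_def Let_def)
  have g: "p * sigma_plus n s = four_block_mat (A * D + (A * B) * S) (A * S + (A * B) * D)
      (transpose_mat A' * S) (transpose_mat A' * D)"
    unfolding p sig using A B D S
    by (subst mult_four_block_mat[of _ n n _ n _ n _ _ n _ n]) auto
  have carr: "p * sigma_plus n s \<in> carrier_mat (n + n) (n + n)"
    unfolding g using A B D S by (intro four_block_carrier_mat) auto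
  then have "p * sigma_plus n s = p * sigma_plus n s * 1\<^sub>m (n + n)"
    by (rule right_mult_one_mat[symmetric])
  then have mem: "p * sigma_plus n s \<in> double_coset (P_plus n) (sigma_plus n s)"
    unfolding double_coset_def using \<open>p \<in> P_plus n\<close> one by blast
  have "mat_trace (A * D + (A * B) * S) = mat_trace (A * D) + mat_trace ((A * B) * S)"
    using A B D S by (simp add: mat_trace_def sum.distrib)
  then have "mat_trace (p * sigma_plus n s) =
      mat_trace (A * D) + mat_trace ((A * B) * S) + mat_trace (transpose_mat A' * D)"
    unfolding g using A B D S by (subst mat_trace_four_block_mat[of _ n _ n]) auto
  also have "\<dots> = (\<Sum>i=s..<n. A $$ (i, i) + A' $$ (i, i)) + (\<Sum>i<s. (A * B) $$ (i, i))"
  proof -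
    have "(\<Sum>i=s..<n. transpose_mat A' $$ (i, i)) = (\<Sum>i=s..<n. A' $$ (i, i))"
      using A by (intro sum.cong) auto
    then show ?thesis
      using A B MD[of A] MD[of "transpose_mat A'"] MS[of "A * B"]
      by (simp add: sum.distrib)
  qed
  finally show ?thesis using mem by blast
qed

lemma double_coset_trace_surj:
  fixes c :: "'a::field"
  assumes two: "(2 :: 'a) = 0" and s: "0 < s" "s < n"
  shows "\<exists>g \<in> double_coset (P_plus n) (sigma_plus n s). mat_trace g = c"
proof -
  let ?A = "addrow_mat n c 0 1" and ?A' = "addrow_mat n (- c) 0 1"
  define B :: "'a mat" where
    "B = mat n n (\<lambda>(i, j). if (i = 0 \<and> j = 1) \<or> (i = 1 \<and> j = 0) then 1 else 0)"
  have n: "0 < n" "1 < n" using s by auto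
  have B: "B \<in> carrier_mat n n" "transpose_mat B = B" "\<forall>i<n. B $$ (i, i) = 0"
    unfolding B_def by (auto intro!: eq_matI)
  have "?A * ?A' = 1\<^sub>m n" "?A' * ?A = 1\<^sub>m n"
    using addrow_mat_inv[OF n, of c] addrow_mat_inv[OF n, of "- c"] by auto
  then have inv: "inverts_mat ?A ?A'" "inverts_mat ?A' ?A"
    by (simp_all add: inverts_mat_def)
  obtain g where g: "g \<in> double_coset (P_plus n) (sigma_plus n s)"
    and tr: "mat_trace g = (\<Sum>i=s..<n. ?A $$ (i, i) + ?A' $$ (i, i)) + (\<Sum>i<s. (?A * B) $$ (i, i))"
    using ex_double_coset_mat_trace[OF _ _ _ inv B, of s] s by auto
  \<comment> \<open>Both matrices have unit diagonal, so every summand is 1 + 1 = 0.\<close>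
  have "(\<Sum>i=s..<n. ?A $$ (i, i) + ?A' $$ (i, i)) = 0"
    using two by (intro sum.neutral) auto
  \<comment> \<open>Multiplying by \<open>?A\<close> adds c times row 1 of \<open>B\<close> to row
    0. This puts c at position (0, 0), which is counted because s > 0, and leaves the other diagonal
    entries 0.\<close>
  moreover have "(\<Sum>i<s. (?A * B) $$ (i, i)) = (\<Sum>i<s. if i = 0 then c else 0)"
    using s n B(1) unfolding addrow_mat[OF B(1) n(2), symmetric]
    by (intro sum.cong) (auto simp: B_def)
  ultimately have "mat_trace g = c" using tr s by simp
  then show ?thesis using g by blast
qed

text \<open>Here s = n - 1 = 0, so \<open>sigma_plus\<close> is the identity, and the zero diagonal
  forces \<open>B\<close> = 0. The two diagonal entries are a unit and its inverse.\<close>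

lemma DC1_1_trace:
  assumes "a \<noteq> (0 :: 'a::field)"
  shows "\<exists>g \<in> DC1 1. mat_trace g = a + inverse a"
proof -
  let ?A = "mat 1 1 (\<lambda>_. a)" and ?A' = "mat 1 1 (\<lambda>_. inverse a)"
  have "inverts_mat ?A ?A'" "inverts_mat ?A' ?A"
    using assms by (auto simp: inverts_mat_def scalar_prod_def intro!: eq_matI)
  then show ?thesis
    unfolding DC1_def
    using ex_double_coset_mat_trace[of 0 1 ?A ?A' "0\<^sub>m 1 1"] by simp
qed

text \<open>Again s = 0. A 2 x 2 matrix with determinant d and trace t has an inverse of trace t /
  d, so the total trace is t (1 + 1/d). This takes every value as t varies, once d is neither 0 nor
  -1.\<close>

lemma DC2_2_trace_surj:
  fixes c :: "'a::finite_field"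
  assumes "CARD('a) \<ge> 4"
  shows "\<exists>g \<in> DC2 2. mat_trace g = c"
proof -
  have "card {0, 1, - 1 :: 'a} \<le> 3"
    using card_insert_le_m1 by (simp add: card_insert_if)
  then have "card {0, 1, - 1 :: 'a} < CARD('a)"
    using assms by linarith
  then have "{0, 1, - 1 :: 'a} \<noteq> UNIV"
    by (metis less_irrefl)
  then have "\<exists>d::'a. d \<notin> {0, 1, - 1}"
    by (metis UNIV_eq_I)
  then obtain d :: 'a where d: "d \<noteq> 0" "d \<noteq> 1" "d \<noteq> - 1"
    by auto
  define t where "t = c / (1 + inverse d)"
  have "d * (1 + inverse d) = d + 1"
    using d by (simp add: distrib_left)
  moreover have "d + 1 \<noteq> 0"
    using d by (simp flip: eq_neg_iff_add_eq_0)
  ultimately have "1 + inverse d \<noteq> 0"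
    by auto
  then have "t * (1 + inverse d) = c"
    unfolding t_def by simp
  then have t: "t + t * inverse d = c"
    by (simp add: distrib_left)
  \<comment> \<open>The companion matrix of X^2 - t X + d, with trace t and determinant d.\<close>
  let ?A = "mat 2 2 (\<lambda>(i, j). if i = 0 then if j = 0 then 0 else - d else if j = 0 then 1 else t)"
  let ?A' = "mat 2 2 (\<lambda>(i, j). if i = 0 then if j = 0 then t / d else 1
    else if j = 0 then - inverse d else 0)"
  have "inverts_mat ?A ?A'" "inverts_mat ?A' ?A"
    using d by (auto simp: inverts_mat_def scalar_prod_def numeral_2_eq_2 less_Suc_eq
        field_simps intro!: eq_matI)
  then obtain g where "g \<in> double_coset (P_plus 2) (sigma_plus 2 0)"
    "mat_trace g = (\<Sum>i=0..<2. ?A $$ (i, i) + ?A' $$ (i, i))"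
    using ex_double_coset_mat_trace[of 0 2 ?A ?A' "0\<^sub>m 2 2"] by auto
  moreover have "(\<Sum>i=0..<2. ?A $$ (i, i) + ?A' $$ (i, i)) = c"
    using t by (simp add: numeral_2_eq_2 divide_inverse add.commute)
  ultimately show ?thesis
    unfolding DC2_def by auto
qed

theorem theorem13:
  fixes r :: nat
  assumes q: "CARD('a::finite_field) = 2 ^ r"
  shows
    "(\<forall>n (gs :: 'a mat list).
        even n \<and> n \<ge> 2 \<and> is_ordering gs (DC1 n) \<longrightarrow>
        F2_linear_iso (length gs) (dual_code (length gs) (code gs)) (codeword r gs)) \<and>
     (\<forall>n (gs :: 'a mat list).
        ((even n \<and> n \<ge> 4) \<or> (n = 2 \<and> CARD('a) \<ge> 4)) \<and> is_ordering gs (DC2 n) \<longrightarrow>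
        F2_linear_iso (length gs) (dual_code (length gs) (code gs)) (codeword r gs)) \<and>
     (\<forall>n (gs :: 'a mat list).
        ((odd n \<and> n \<ge> 3) \<or> (n = 1 \<and> CARD('a) \<ge> 8)) \<and> is_ordering gs (DC1 n) \<longrightarrow>
        F2_linear_iso (length gs) (dual_code (length gs) (code gs)) (codeword r gs)) \<and>
     (\<forall>n (gs :: 'a mat list).
        odd n \<and> n \<ge> 3 \<and> is_ordering gs (DC2 n) \<longrightarrow>
        F2_linear_iso (length gs) (dual_code (length gs) (code gs)) (codeword r gs))"
proof -
  \<comment> \<open>The cases are sorted by s rather than by the parity of n: 0 < s < n holds for s
    = n - 1 when n \<ge> 2 and for s = n - 2 when n \<ge> 3. The cases 3 and 4 have s = 0.\<close>
  have 1: "F2_linear_iso (length gs) (dual_code (length gs) (code gs)) (codeword r gs)"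
    if "is_ordering gs (DC1 n)" "n \<ge> 2" for n and gs :: "'a mat list"
    using that double_coset_trace_surj[OF two_eq_zero[OF q], of "n - 1" n]
    unfolding is_ordering_def DC1_def by (intro F2_linear_iso_of_surj_trace[OF q]) auto
  have 2: "F2_linear_iso (length gs) (dual_code (length gs) (code gs)) (codeword r gs)"
    if "is_ordering gs (DC2 n)" "n \<ge> 3" for n and gs :: "'a mat list"
    using that double_coset_trace_surj[OF two_eq_zero[OF q], of "n - 2" n]
    unfolding is_ordering_def DC2_def by (intro F2_linear_iso_of_surj_trace[OF q]) auto
  have 3: "F2_linear_iso (length gs) (dual_code (length gs) (code gs)) (codeword r gs)"
    if "is_ordering gs (DC2 2)" "CARD('a) \<ge> 4" for gs :: "'a mat list"
    using that DC2_2_trace_surj unfolding is_ordering_def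
    by (intro F2_linear_iso_of_surj_trace[OF q]) auto
  have 4: "F2_linear_iso (length gs) (dual_code (length gs) (code gs)) (codeword r gs)"
    if "is_ordering gs (DC1 1)" "CARD('a) \<ge> 8" for gs :: "'a mat list"
  proof (rule F2_linear_iso_codeword[OF q])
    fix b :: 'a assume *: "\<forall>g\<in>set gs. tr r (b * mat_trace g) = 0"
    show "b = 0"
    proof (rule tr_add_inverse_eq_0_imp[OF q that(2)])
      fix a :: 'a assume "a \<noteq> 0"
      then obtain g where "g \<in> DC1 1" "mat_trace g = a + inverse a"
        using DC1_1_trace by blast
      then show "tr r (b * (a + inverse a)) = 0"
        using * that(1) unfolding is_ordering_def by metis
    qed
  qed
  show ?thesis
    using 1 2 3 4 by (intro conjI allI impI; elim conjE disjE; simp)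
qed

end
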